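(* Let $p\ge0$, $q\ge1$ be integers, $\alpha_1,\dots,\alpha_p>0$, $\beta_1,\dots,\beta_q>0$. (i) Let $A_1,\dots,A_p\ge0$, $B_1,\dots,B_q\ge0$ be such that $\epsilon=1+\sum_{l=1}^qB_l-\sum_{l=1}^pA_l>0$, and for $b>0$ let $$\Psi(b;z)={}_p\Psi_q\Big[\begin{matrix}(\alpha_1,A_1),\dots,(\alpha_p,A_p)\\ (b,B_1),(\beta_2,B_2),\dots,(\beta_q,B_q)\end{matrix}\Big|z\Big].$$ Then for all $z\in(0,\infty)$ $$\Psi(\beta_1;z)\,\Psi(\beta_1+2;z)-\frac{\beta_1}{\beta_1+1}\big(\Psi(\beta_1+1;z)\big)^2\ge0.$$ (ii) Moreover, if $p\le q$, then for all $z\in(0,\infty)$ $${}_pF_q\Big[\begin{matrix}\alpha_1,\dots,\alpha_p\\ \beta_1,\beta_2,\dots,\beta_q\end{matrix}\Big|z\Big]\;{}_pF_q\Big[\begin{matrix}\alpha_1,\dots,\alpha_p\\ \beta_1+2,\beta_2,\dots,\beta_q\end{matrix}\Big|z\Big]-\Big({}_pF_q\Big[\begin{matrix}\alpha_1,\dots,\alpha_p\\ \beta_1+1,\beta_2,\dots,\beta_q\end{matrix}\Big|z\Big]\Big)^2\ge0.$$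
   Context: The Fox-Wright function is $${}_p\Psi_q\Big[\begin{matrix}(\alpha_1,A_1),\dots,(\alpha_p,A_p)\\ (\beta_1,B_1),\dots,(\beta_q,B_q)\end{matrix}\Big|z\Big]=\sum_{k=0}^\infty\frac{\prod_{l=1}^p\Gamma(\alpha_l+kA_l)}{\prod_{l=1}^q\Gamma(\beta_l+kB_l)}\frac{z^k}{k!},$$ where $A_l,B_l\ge0$; it converges for all $z$ when $\epsilon=1+\sum_{l=1}^qB_l-\sum_{l=1}^pA_l>0$. The generalized hypergeometric function is $${}_pF_q\Big[\begin{matrix}\alpha_1,\dots,\alpha_p\\ \beta_1,\dots,\beta_q\end{matrix}\Big|z\Big]=\sum_{k=0}^\infty\frac{\prod_{l=1}^p(\alpha_l)_k}{\prod_{l=1}^q(\beta_l)_k}\frac{z^k}{k!},$$ with $(\tau)_0=1$, $(\tau)_k=\tau(\tau+1)\cdots(\tau+k-1)$ for $k\ge1$. *)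

theory Defs
  imports "HOL-Analysis.Analysis"
begin

text \<open>
  The parameters are given by functions on \<^typ>\<open>nat\<close> of which only the values on
  \<open>{1..p}\<close> (numerator) and \<open>{1..q}\<close> (denominator) matter.  Both series are plain
  \<^const>\<open>suminf\<close>s, so the values are meaningful only where the series converge;
  \<^const>\<open>Gamma\<close> is only meant to be evaluated at positive arguments.
\<close>

definition fox_wright ::
  "nat \<Rightarrow> (nat \<Rightarrow> real) \<Rightarrow> (nat \<Rightarrow> real) \<Rightarrow> nat \<Rightarrow> (nat \<Rightarrow> real) \<Rightarrow> (nat \<Rightarrow> real) \<Rightarrow> real \<Rightarrow> real"
  where "fox_wright p \<alpha> A q \<beta> B z =
    (\<Sum>k. (\<Prod>l=1..p. Gamma (\<alpha> l + real k * A l)) / (\<Prod>l=1..q. Gamma (\<beta> l + real k * B l))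
          * (z ^ k / fact k))"

definition hypergeometric ::
  "nat \<Rightarrow> (nat \<Rightarrow> real) \<Rightarrow> nat \<Rightarrow> (nat \<Rightarrow> real) \<Rightarrow> real \<Rightarrow> real"
  where "hypergeometric p \<alpha> q \<beta> z =
    (\<Sum>k. (\<Prod>l=1..p. pochhammer (\<alpha> l) k) / (\<Prod>l=1..q. pochhammer (\<beta> l) k) * (z ^ k / fact k))"

lemma foldl_times_prod:
  fixes f :: "nat \<Rightarrow> real"
  shows "foldl (\<lambda>r a. r * pochhammer a n) 1 (map f [1..<Suc p]) = (\<Prod>l=1..p. pochhammer (f l) n)"
  by (induction p) (auto simp: mult.commute)

lemma hypergeometric_eq_eval_fps:
  "hypergeometric p \<alpha> q \<beta> z =
     eval_fps (fps_hypergeo (map \<alpha> [1..<Suc p]) (map \<beta> [1..<Suc q]) 1) z"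
  unfolding hypergeometric_def eval_fps_def fps_hypergeo_nth foldl_times_prod by simp

end

theory Submission
  imports Defs "HOL-Real_Asymp.Real_Asymp"
begin

text \<open>
  Write \<open>w\<^sub>k\<close> for the summands of \<open>\<Psi>(\<beta>\<^sub>1;z)\<close> and \<open>x\<^sub>k = \<beta>\<^sub>1 + k B\<^sub>1\<close>. By the functional
  equation of \<open>\<Gamma>\<close>, raising \<open>\<beta>\<^sub>1\<close> by 1 or by 2 turns the summand \<open>w\<^sub>k\<close> into
  \<open>w\<^sub>k / x\<^sub>k\<close> or into \<open>w\<^sub>k / (x\<^sub>k (x\<^sub>k + 1))\<close>. As \<open>x\<^sub>k \<ge> \<beta>\<^sub>1\<close> and \<open>x / (x + 1)\<close> increases,
  \<open>1 / (x\<^sub>k (x\<^sub>k + 1)) \<ge> \<beta>\<^sub>1 / (\<beta>\<^sub>1 + 1) \<cdot> (1 / x\<^sub>k)\<^sup>2\<close>. So (i) is the Cauchy-Schwarz inequality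
  \<open>(\<Sum> w\<^sub>k u\<^sub>k)\<^sup>2 \<le> (\<Sum> w\<^sub>k) (\<Sum> w\<^sub>k u\<^sub>k\<^sup>2)\<close> with \<open>u\<^sub>k = 1 / x\<^sub>k\<close>
  (lemma \<open>weighted_Cauchy_Schwarz_suminf\<close>).

  For the series to mean anything they must converge, and this is where \<open>\<epsilon> > 0\<close> enters.
  Log-convexity of \<open>\<Gamma>\<close> bounds \<open>\<Gamma>(x + a) / \<Gamma>(x)\<close> between \<open>(x - 1)\<^sup>a\<close> and \<open>(x + a)\<^sup>a\<close> for \<open>x > 1\<close>, so
  the quotient of consecutive summands is of order \<open>k\<close> to the power \<open>-\<epsilon>\<close>, and the ratio test
  applies (lemma \<open>summable_fox_wright\<close>).

  Part (ii) is a special case of (i): with all \<open>A\<^sub>l = B\<^sub>l = 1\<close> the condition \<open>\<epsilon> > 0\<close> reads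
  \<open>p < q + 1\<close>, and \<open>\<Psi>\<close> differs from the hypergeometric function by a constant factor. That
  factor contains \<open>\<Gamma>(\<beta>\<^sub>1)\<close>, and
  \<open>\<Gamma>(\<beta>\<^sub>1) \<Gamma>(\<beta>\<^sub>1 + 2) = (\<beta>\<^sub>1 + 1) / \<beta>\<^sub>1 \<cdot> \<Gamma>(\<beta>\<^sub>1 + 1)\<^sup>2\<close> cancels the constant in (i).
\<close>

section \<open>Growth of Gamma quotients\<close>

text \<open>
  The slope of the convex function \<open>ln \<circ> \<Gamma>\<close> over \<open>[x, x + a]\<close> lies between its slopes over the
  unit intervals \<open>[x - 1, x]\<close> and \<open>[x + a, x + a + 1]\<close>, which are \<open>ln (x - 1)\<close> and
  \<open>ln (x + a)\<close>.
\<close>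

lemma Gamma_ratio_powr_bounds:
  fixes x a :: real
  assumes "x > 1" "a \<ge> 0"
  shows "(x - 1) powr a \<le> Gamma (x + a) / Gamma x"
    and "Gamma (x + a) / Gamma x \<le> (x + a) powr a"
proof -
  let ?g = "\<lambda>x::real. ln (Gamma x)"
  have conv: "convex_on {0<..} ?g"
    using log_convex_Gamma_real by (simp add: o_def)
  have step: "?g (y + 1) = ?g y + ln y" if "y > 0" for y :: real
  proof -
    have "y \<notin> \<int>\<^sub>\<le>\<^sub>0" using that by auto
    then show ?thesis using that Gamma_real_pos[OF that] by (simp add: Gamma_plus1 ln_mult_pos)
  qed
  have "a * ln (x - 1) \<le> ?g (x + a) - ?g x \<and> ?g (x + a) - ?g x \<le> a * ln (x + a)"
  proof (cases "a = 0")
    case False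
    with assms have a: "a > 0" by simp
    note lower = convex_on_slope_le[OF conv, of "x - 1" "x + a" x]
    note upper = convex_on_slope_le[OF conv, of x "x + a + 1" "x + a"]
    have "?g x - ?g (x - 1) = ln (x - 1)" using step[of "x - 1"] assms by simp
    then have "ln (x - 1) \<le> (?g (x + a) - ?g x) / a"
      using order_trans[OF lower(1,2)] a assms by (simp add: field_simps)
    moreover have "?g (x + a + 1) - ?g (x + a) = ln (x + a)" using step[of "x + a"] assms by simp
    then have "(?g (x + a) - ?g x) / a \<le> ln (x + a)"
      using order_trans[OF upper(1,2)] a assms by (simp add: field_simps)
    ultimately show ?thesis using a by (simp add: field_simps)
  qed auto
  moreover have "Gamma (x + a) / Gamma x = exp (?g (x + a) - ?g x)"
    using assms by (simp add: exp_diff)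
  ultimately show "(x - 1) powr a \<le> Gamma (x + a) / Gamma x"
    and "Gamma (x + a) / Gamma x \<le> (x + a) powr a"
    using assms by (auto simp: powr_def)
qed

text \<open>
  For \<open>a > 0\<close> the arguments \<open>c + k a\<close> grow linearly in \<open>k\<close>, and both bounds above are of order
  \<open>k\<^sup>a\<close>. For \<open>a = 0\<close> the arguments need never exceed 1, but then the quotient is constantly 1.
\<close>

lemma Gamma_progression_ratio_bigtheta:
  fixes c a :: real
  assumes "a \<ge> 0" "c > 0"
  shows "(\<lambda>k. Gamma (c + real (Suc k) * a) / Gamma (c + real k * a)) \<in> \<Theta>(\<lambda>k. real k powr a)"
proof (cases "a = 0")
  case True
  have "(\<lambda>k. Gamma c / Gamma c) \<in> \<Theta>(\<lambda>k. real k powr 0)"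
    using Gamma_real_pos[OF assms(2)]
    by (intro bigthetaI_cong eventually_mono[OF eventually_gt_at_top[of 0]]) simp
  with True show ?thesis by simp
next
  case False
  with assms have a: "a > 0" by simp
  let ?r = "\<lambda>k. Gamma (c + real (Suc k) * a) / Gamma (c + real k * a)"
  have large: "eventually (\<lambda>k. c + real k * a > 1) sequentially"
    using a by real_asymp
  have lower: "eventually (\<lambda>k. (c + real k * a - 1) powr a \<le> ?r k) sequentially"
    and upper: "eventually (\<lambda>k. ?r k \<le> (c + real k * a + a) powr a) sequentially"
    using large Gamma_ratio_powr_bounds[of "c + real k * a" a for k] assms
    by (auto elim!: eventually_mono simp: algebra_simps)
  have "?r k > 0" for k
    using assms by (intro divide_pos_pos Gamma_real_pos add_pos_nonneg) auto
  then have norm_ratio: "\<bar>?r k\<bar> = ?r k" for k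
    by (rule abs_of_pos)
  show ?thesis
  proof (rule bigthetaI)
    have "?r \<in> O(\<lambda>k. (c + real k * a + a) powr a)"
      using upper
      by (intro landau_o.big_mono) (simp only: norm_ratio real_norm_def abs_of_nonneg powr_ge_zero)
    also have "(\<lambda>k. (c + real k * a + a) powr a) \<in> O(\<lambda>k. real k powr a)"
      using a by real_asymp
    finally show "?r \<in> O(\<lambda>k. real k powr a)" .
    have "(\<lambda>k. real k powr a) \<in> O(\<lambda>k. (c + real k * a - 1) powr a)"
      using a by real_asymp
    also have "(\<lambda>k. (c + real k * a - 1) powr a) \<in> O(?r)"
      using lower
      by (intro landau_o.big_mono) (simp only: norm_ratio real_norm_def abs_of_nonneg powr_ge_zero)
    finally show "?r \<in> \<Omega>(\<lambda>k. real k powr a)" by (simp add: bigomega_iff_bigo)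
  qed
qed

section \<open>Convergence of the Fox-Wright series\<close>

definition fox_wright_term ::
  "nat \<Rightarrow> (nat \<Rightarrow> real) \<Rightarrow> (nat \<Rightarrow> real) \<Rightarrow> nat \<Rightarrow> (nat \<Rightarrow> real) \<Rightarrow> (nat \<Rightarrow> real) \<Rightarrow> real \<Rightarrow> nat \<Rightarrow> real"
  where "fox_wright_term p \<alpha> A q \<beta> B z k =
    (\<Prod>l=1..p. Gamma (\<alpha> l + real k * A l)) / (\<Prod>l=1..q. Gamma (\<beta> l + real k * B l))
      * (z ^ k / fact k)"

lemma fox_wright_term_pos:
  assumes "\<And>l. l \<in> {1..p} \<Longrightarrow> \<alpha> l > 0" "\<And>l. l \<in> {1..q} \<Longrightarrow> \<beta> l > 0"
    and "\<And>l. l \<in> {1..p} \<Longrightarrow> A l \<ge> 0" "\<And>l. l \<in> {1..q} \<Longrightarrow> B l \<ge> 0"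
    and "z > 0"
  shows "fox_wright_term p \<alpha> A q \<beta> B z k > 0"
  unfolding fox_wright_term_def using assms
  by (intro mult_pos_pos divide_pos_pos prod_pos) (auto intro!: Gamma_real_pos add_pos_nonneg)

text \<open>
  Every Gamma factor changes from one summand to the next by a ratio of order \<open>k\<close> to the power
  of its step, so the summands have ratio \<open>O(k\<^sup>s)\<close> with \<open>s = \<Sum>A - \<Sum>B - 1 < 0\<close>.
\<close>

lemma summable_fox_wright:
  assumes "\<And>l. l \<in> {1..p} \<Longrightarrow> \<alpha> l > 0" "\<And>l. l \<in> {1..q} \<Longrightarrow> \<beta> l > 0"
    and "\<And>l. l \<in> {1..p} \<Longrightarrow> A l \<ge> 0" "\<And>l. l \<in> {1..q} \<Longrightarrow> B l \<ge> 0"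
    and "1 + (\<Sum>l=1..q. B l) - (\<Sum>l=1..p. A l) > 0"
    and "z > 0"
  shows "summable (fox_wright_term p \<alpha> A q \<beta> B z)"
proof -
  let ?w = "fox_wright_term p \<alpha> A q \<beta> B z"
  define s where "s = (\<Sum>l=1..p. A l) - (\<Sum>l=1..q. B l) - 1"
  have s: "s < 0" using assms(5) by (simp add: s_def)
  let ?N = "\<lambda>k. \<Prod>l=1..p. Gamma (\<alpha> l + real (Suc k) * A l) / Gamma (\<alpha> l + real k * A l)"
  let ?D = "\<lambda>k. \<Prod>l=1..q. Gamma (\<beta> l + real k * B l) / Gamma (\<beta> l + real (Suc k) * B l)"
  have pos: "?w k > 0" for k
    using assms by (intro fox_wright_term_pos) auto
  have powr_sum_prod: "(\<Prod>l\<in>I. real k powr e l) = real k powr (\<Sum>l\<in>I. e l)"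
    if "k > 0" for k :: nat and e :: "nat \<Rightarrow> real" and I
    using that by (simp add: powr_sum)
  have ratio: "?w (Suc k) / ?w k = ?N k * ?D k * (z / real (Suc k))" for k
    using assms(6) unfolding fox_wright_term_def
    by (simp add: prod_dividef divide_simps)
  have num: "?N \<in> O(\<lambda>k. \<Prod>l=1..p. real k powr A l)"
    using assms by (intro landau_o.big_prod bigthetaD1 Gamma_progression_ratio_bigtheta) auto
  have den: "?D \<in> O(\<lambda>k. \<Prod>l=1..q. real k powr (- B l))"
  proof (rule landau_o.big_prod)
    fix l assume l: "l \<in> {1..q}"
    have "(\<lambda>k. inverse (Gamma (\<beta> l + real (Suc k) * B l) / Gamma (\<beta> l + real k * B l)))
            \<in> \<Theta>(\<lambda>k. inverse (real k powr B l))"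
      using Gamma_progression_ratio_bigtheta[of "B l" "\<beta> l"] assms l
      by (intro bigtheta_inverse[THEN iffD2]) auto
    then show "(\<lambda>k. Gamma (\<beta> l + real k * B l) / Gamma (\<beta> l + real (Suc k) * B l))
            \<in> O(\<lambda>k. real k powr (- B l))"
      by (intro bigthetaD1) (simp add: powr_minus)
  qed
  have "(\<lambda>k. ?N k * ?D k * (z / real (Suc k)))
     \<in> O(\<lambda>k. (\<Prod>l=1..p. real k powr A l) * (\<Prod>l=1..q. real k powr (- B l)) * real k powr (-1))"
    by (intro landau_o.big.mult num den) real_asymp
  also have "(\<lambda>k. (\<Prod>l=1..p. real k powr A l) * (\<Prod>l=1..q. real k powr (- B l)) * real k powr (-1))
     \<in> \<Theta>(\<lambda>k. real k powr s)"
    by (intro bigthetaI_cong eventually_mono[OF eventually_gt_at_top[of 0]])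
       (simp only: powr_sum_prod flip: powr_add, simp add: s_def sum_negf)
  also have "(\<lambda>k. real k powr s) \<in> o(\<lambda>_. 1)" using s by real_asymp
  finally have "(\<lambda>k. ?w (Suc k) / ?w k) \<in> o(\<lambda>_. 1)"
    by (simp only: ratio)
  from landau_o.smallD[OF this, of "1/2"]
  have "eventually (\<lambda>k. norm (?w (Suc k)) \<le> 1/2 * norm (?w k)) sequentially"
    using pos by (auto elim!: eventually_mono simp: divide_simps abs_of_pos mult.commute)
  then obtain n where "\<And>k. k \<ge> n \<Longrightarrow> norm (?w (Suc k)) \<le> 1/2 * norm (?w k)"
    unfolding eventually_sequentially by auto
  then show ?thesis by (intro summable_ratio_test[of "1/2" n]) auto
qed

section \<open>The inequality for Fox-Wright functions\<close>

text \<open>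
  Summing \<open>w (u - t)\<^sup>2 \<ge> 0\<close> bounds \<open>\<Sum> w u\<^sup>2\<close> below by \<open>2 t \<Sum> w u - t\<^sup>2 \<Sum> w\<close>, which is
  largest when \<open>t\<close> is the weighted mean of \<open>u\<close>. Using \<open>v\<close> in place of \<open>c u\<^sup>2\<close> leaves
  room for the factor \<open>x / (x + 1)\<close> that separates \<open>1 / (x (x + 1))\<close> from \<open>1 / x\<^sup>2\<close>.
\<close>

lemma weighted_Cauchy_Schwarz_suminf:
  fixes w u v :: "nat \<Rightarrow> real"
  assumes "summable w" "summable (\<lambda>k. w k * u k)" "summable (\<lambda>k. w k * v k)"
    and pos: "\<And>k. w k > 0"
    and "c \<ge> 0" "\<And>k. v k \<ge> c * (u k)\<^sup>2"
  shows "c * (\<Sum>k. w k * u k)\<^sup>2 \<le> (\<Sum>k. w k) * (\<Sum>k. w k * v k)"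
proof -
  let ?S0 = "\<Sum>k. w k" and ?S1 = "\<Sum>k. w k * u k" and ?S2 = "\<Sum>k. w k * v k"
  have S0: "?S0 > 0" using assms by (intro suminf_pos) auto
  define t where "t = ?S1 / ?S0"
  have le: "c * (2 * t * (w k * u k) - t\<^sup>2 * w k) \<le> w k * v k" for k
  proof -
    have "0 \<le> (u k - t)\<^sup>2" by simp
    then have "2 * t * u k - t\<^sup>2 \<le> (u k)\<^sup>2" by (simp add: power2_diff algebra_simps)
    then have "c * (2 * t * u k - t\<^sup>2) \<le> v k"
      using mult_left_mono[OF _ \<open>c \<ge> 0\<close>] assms(6)[of k] order_trans by blast
    then have "w k * (c * (2 * t * u k - t\<^sup>2)) \<le> w k * v k"
      using pos[of k] by (intro mult_left_mono) auto
    then show ?thesis by (simp add: algebra_simps)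
  qed
  have "(\<lambda>k. c * (2 * t * (w k * u k) - t\<^sup>2 * w k)) sums (c * (2 * t * ?S1 - t\<^sup>2 * ?S0))"
    using assms by (intro sums_mult sums_diff summable_sums)
  then have "c * (2 * t * ?S1 - t\<^sup>2 * ?S0) \<le> ?S2"
    by (rule sums_le[OF le _ summable_sums[OF assms(3)]])
  moreover have "2 * t * ?S1 - t\<^sup>2 * ?S0 = ?S1\<^sup>2 / ?S0"
    using S0 unfolding t_def by (simp add: field_simps power2_eq_square)
  ultimately have "c * ?S1\<^sup>2 / ?S0 \<le> ?S2" by (simp only: times_divide_eq_right)
  then show ?thesis using S0 by (simp only: pos_divide_le_eq mult.commute)
qed

lemma fox_wright_term_shift:
  assumes "q \<ge> 1" "b > 0" "B 1 \<ge> 0"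
  shows "fox_wright_term p \<alpha> A q (\<beta>(1 := b + 1)) B z k =
         fox_wright_term p \<alpha> A q (\<beta>(1 := b)) B z k * (1 / (b + real k * B 1))"
proof -
  have x: "b + real k * B 1 > 0" using assms by (intro add_pos_nonneg) auto
  then have notin: "b + real k * B 1 \<notin> \<int>\<^sub>\<le>\<^sub>0" by auto
  have split: "(\<Prod>l=1..q. Gamma ((\<beta>(1 := c)) l + real k * B l)) =
      Gamma (c + real k * B 1) * (\<Prod>l=2..q. Gamma (\<beta> l + real k * B l))" for c
    using assms(1) by (subst prod.atLeast_Suc_atMost) (auto intro!: prod.cong simp: numeral_2_eq_2)
  have "Gamma (b + 1 + real k * B 1) = (b + real k * B 1) * Gamma (b + real k * B 1)"
    using Gamma_plus1[OF notin] by (simp add: add_ac)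
  then show ?thesis unfolding fox_wright_term_def split by simp
qed

text \<open>
  Cauchy-Schwarz with \<open>u = 1 / x\<close> and \<open>v = 1 / (x (x + 1))\<close>, where \<open>x\<^sub>k = \<beta>\<^sub>1 + k B\<^sub>1\<close>. The
  constant \<open>c = \<beta>\<^sub>1 / (\<beta>\<^sub>1 + 1)\<close> is the value of \<open>v / u\<^sup>2 = x / (x + 1)\<close> at \<open>k = 0\<close>, where it is
  smallest because \<open>B\<^sub>1 \<ge> 0\<close>.
\<close>

lemma fox_wright_Turan_inequality:
  assumes "q \<ge> 1"
    and \<alpha>: "\<And>l. l \<in> {1..p} \<Longrightarrow> \<alpha> l > 0" and \<beta>: "\<And>l. l \<in> {1..q} \<Longrightarrow> \<beta> l > 0"
    and A: "\<And>l. l \<in> {1..p} \<Longrightarrow> A l \<ge> 0" and B: "\<And>l. l \<in> {1..q} \<Longrightarrow> B l \<ge> 0"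
    and \<epsilon>: "1 + (\<Sum>l=1..q. B l) - (\<Sum>l=1..p. A l) > 0"
    and "z > 0"
  shows "\<beta> 1 / (\<beta> 1 + 1) * (fox_wright p \<alpha> A q (\<beta>(1 := \<beta> 1 + 1)) B z)\<^sup>2
    \<le> fox_wright p \<alpha> A q \<beta> B z * fox_wright p \<alpha> A q (\<beta>(1 := \<beta> 1 + 2)) B z"
proof -
  let ?t = "\<lambda>b. fox_wright_term p \<alpha> A q (\<beta>(1 := b)) B z"
  define w where "w = ?t (\<beta> 1)"
  define x where "x k = \<beta> 1 + real k * B 1" for k
  have b: "\<beta> 1 > 0" and B1: "B 1 \<ge> 0" using assms by auto
  have x: "x k \<ge> \<beta> 1" for k using B1 by (simp add: x_def)
  have xpos: "x k > 0" for k using x[of k] b by linarith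
  have fw: "fox_wright p \<alpha> A q (\<beta>(1 := c)) B z = (\<Sum>k. ?t c k)" for c
    unfolding fox_wright_def fox_wright_term_def by simp
  have sm: "summable (?t c)" if "c > 0" for c
    using that assms by (intro summable_fox_wright) auto
  have shift1: "?t (\<beta> 1 + 1) = (\<lambda>k. w k * (1 / x k))"
    using fox_wright_term_shift[of q "\<beta> 1" B] assms(1) b B1 by (auto simp: w_def x_def)
  have shift2: "?t (\<beta> 1 + 2) = (\<lambda>k. w k * (1 / (x k * (x k + 1))))"
  proof
    fix k
    have "?t (\<beta> 1 + 1 + 1) k = ?t (\<beta> 1 + 1) k * (1 / (\<beta> 1 + 1 + real k * B 1))"
      using assms(1) b B1 by (intro fox_wright_term_shift) auto
    moreover have "\<beta> 1 + 1 + 1 = \<beta> 1 + 2" "\<beta> 1 + 1 + real k * B 1 = x k + 1"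
      by (simp_all add: x_def)
    moreover have "?t (\<beta> 1 + 1) k = w k * (1 / x k)" by (rule fun_cong[OF shift1])
    ultimately show "?t (\<beta> 1 + 2) k = w k * (1 / (x k * (x k + 1)))"
      by (simp only:) simp
  qed
  have "\<beta> 1 / (\<beta> 1 + 1) * (\<Sum>k. w k * (1 / x k))\<^sup>2
      \<le> (\<Sum>k. w k) * (\<Sum>k. w k * (1 / (x k * (x k + 1))))"
  proof (rule weighted_Cauchy_Schwarz_suminf)
    show "summable w" "summable (\<lambda>k. w k * (1 / x k))"
      "summable (\<lambda>k. w k * (1 / (x k * (x k + 1))))"
      using sm[of "\<beta> 1"] sm[of "\<beta> 1 + 1"] sm[of "\<beta> 1 + 2"] b
      unfolding shift1 shift2 by (auto simp: w_def)
    show "w k > 0" for k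
      unfolding w_def using assms by (intro fox_wright_term_pos) auto
    show "\<beta> 1 / (\<beta> 1 + 1) \<ge> 0" using b by simp
    show "\<beta> 1 / (\<beta> 1 + 1) * (1 / x k)\<^sup>2 \<le> 1 / (x k * (x k + 1))" for k
    proof -
      have "\<beta> 1 / (\<beta> 1 + 1) \<le> x k / (x k + 1)"
        using x[of k] xpos[of k] b by (simp add: field_simps)
      then have "\<beta> 1 / (\<beta> 1 + 1) * (1 / x k)\<^sup>2 \<le> x k / (x k + 1) * (1 / x k)\<^sup>2"
        by (rule mult_right_mono) simp
      also have "\<dots> = 1 / (x k * (x k + 1))"
        using xpos[of k] by (simp add: power2_eq_square)
      finally show ?thesis .
    qed
  qed
  then show ?thesis
    using fw[of "\<beta> 1"] fw[of "\<beta> 1 + 1"] fw[of "\<beta> 1 + 2"]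
    unfolding shift1 shift2 by (simp add: w_def)
qed

section \<open>The hypergeometric case\<close>

text \<open>
  Convergence is used to pull the constant out of the series: \<open>p \<le> q\<close> is the condition
  \<open>\<epsilon> > 0\<close> for unit steps.
\<close>

lemma hypergeometric_eq_fox_wright:
  assumes "\<And>l. l \<in> {1..p} \<Longrightarrow> \<alpha> l > 0" "\<And>l. l \<in> {1..q} \<Longrightarrow> \<beta> l > 0"
    and "p \<le> q" "z > 0"
  shows "hypergeometric p \<alpha> q \<beta> z =
    (\<Prod>l=1..q. Gamma (\<beta> l)) / (\<Prod>l=1..p. Gamma (\<alpha> l))
      * fox_wright p \<alpha> (\<lambda>_. 1) q \<beta> (\<lambda>_. 1) z"
proof -
  let ?w = "fox_wright_term p \<alpha> (\<lambda>_. 1) q \<beta> (\<lambda>_. 1) z"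
  let ?C = "(\<Prod>l=1..q. Gamma (\<beta> l)) / (\<Prod>l=1..p. Gamma (\<alpha> l))"
  have poch: "(\<Prod>l\<in>I. pochhammer (a l) k) = (\<Prod>l\<in>I. Gamma (a l + real k)) / (\<Prod>l\<in>I. Gamma (a l))"
    if "\<And>l. l \<in> I \<Longrightarrow> a l > 0" for a :: "nat \<Rightarrow> real" and I k
  proof -
    have "a l \<notin> \<int>\<^sub>\<le>\<^sub>0" if "l \<in> I" for l using \<open>\<And>l. l \<in> I \<Longrightarrow> a l > 0\<close>[OF that] by auto
    then show ?thesis by (simp add: pochhammer_Gamma flip: prod_dividef)
  qed
  have "summable ?w"
    using assms by (intro summable_fox_wright) auto
  then have "(\<Sum>k. ?C * ?w k) = ?C * (\<Sum>k. ?w k)"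
    by (rule suminf_mult)
  moreover have "(\<Prod>l=1..p. pochhammer (\<alpha> l) k) / (\<Prod>l=1..q. pochhammer (\<beta> l) k) * (z ^ k / fact k)
      = ?C * ?w k" for k
  proof -
    have "(\<Prod>l=1..p. pochhammer (\<alpha> l) k) = (\<Prod>l=1..p. Gamma (\<alpha> l + real k)) / (\<Prod>l=1..p. Gamma (\<alpha> l))"
      and "(\<Prod>l=1..q. pochhammer (\<beta> l) k) = (\<Prod>l=1..q. Gamma (\<beta> l + real k)) / (\<Prod>l=1..q. Gamma (\<beta> l))"
      using assms by (intro poch; simp)+
    then show ?thesis unfolding fox_wright_term_def by (simp add: mult_ac)
  qed
  ultimately show ?thesis
    unfolding hypergeometric_def fox_wright_def by (simp add: fox_wright_term_def)
qed

lemma hypergeometric_Turan_inequality: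
  assumes "q \<ge> 1"
    and \<alpha>: "\<And>l. l \<in> {1..p} \<Longrightarrow> \<alpha> l > 0" and \<beta>: "\<And>l. l \<in> {1..q} \<Longrightarrow> \<beta> l > 0"
    and "p \<le> q" "z > 0"
  shows "(hypergeometric p \<alpha> q (\<beta>(1 := \<beta> 1 + 1)) z)\<^sup>2
    \<le> hypergeometric p \<alpha> q \<beta> z * hypergeometric p \<alpha> q (\<beta>(1 := \<beta> 1 + 2)) z"
proof -
  let ?\<Psi> = "\<lambda>b. fox_wright p \<alpha> (\<lambda>_. 1) q (\<beta>(1 := b)) (\<lambda>_. 1) z"
  let ?G = "Gamma (\<beta> 1 + 1)"
  define C where "C = (\<Prod>l=2..q. Gamma (\<beta> l)) / (\<Prod>l=1..p. Gamma (\<alpha> l))"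
  have b: "\<beta> 1 > 0" using assms by auto
  have H: "hypergeometric p \<alpha> q (\<beta>(1 := c)) z = C * Gamma c * ?\<Psi> c" if "c > 0" for c
  proof -
    have "(\<Prod>l=1..q. Gamma ((\<beta>(1 := c)) l)) = Gamma c * (\<Prod>l=2..q. Gamma (\<beta> l))"
      using assms(1) by (subst prod.atLeast_Suc_atMost) (auto intro!: prod.cong simp: numeral_2_eq_2)
    moreover have "hypergeometric p \<alpha> q (\<beta>(1 := c)) z =
        (\<Prod>l=1..q. Gamma ((\<beta>(1 := c)) l)) / (\<Prod>l=1..p. Gamma (\<alpha> l)) * ?\<Psi> c"
      using that assms by (intro hypergeometric_eq_fox_wright) auto
    ultimately show ?thesis by (simp add: C_def)
  qed
  have "\<beta> 1 \<notin> \<int>\<^sub>\<le>\<^sub>0" "\<beta> 1 + 1 \<notin> \<int>\<^sub>\<le>\<^sub>0" using b by (auto dest: nonpos_Ints_nonpos)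
  then have "?G = \<beta> 1 * Gamma (\<beta> 1)" "Gamma (\<beta> 1 + 2) = (\<beta> 1 + 1) * ?G"
    using Gamma_plus1[of "\<beta> 1"] Gamma_plus1[of "\<beta> 1 + 1"] by (simp_all add: add_ac)
  \<comment> \<open>this identity absorbs the constant of the Fox-Wright inequality\<close>
  then have GG: "Gamma (\<beta> 1) * Gamma (\<beta> 1 + 2) * (\<beta> 1 / (\<beta> 1 + 1)) = ?G\<^sup>2"
    using b by (simp add: power2_eq_square)
  have "0 \<le> Gamma (\<beta> 1) * Gamma (\<beta> 1 + 2)"
    using b by (intro mult_nonneg_nonneg less_imp_le Gamma_real_pos) auto
  moreover have "\<beta> 1 / (\<beta> 1 + 1) * (?\<Psi> (\<beta> 1 + 1))\<^sup>2 \<le> ?\<Psi> (\<beta> 1) * ?\<Psi> (\<beta> 1 + 2)"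
    using fox_wright_Turan_inequality[of q p \<alpha> \<beta> "\<lambda>_. 1" "\<lambda>_. 1" z] assms by simp
  ultimately have "C\<^sup>2 * (Gamma (\<beta> 1) * Gamma (\<beta> 1 + 2)) * (\<beta> 1 / (\<beta> 1 + 1) * (?\<Psi> (\<beta> 1 + 1))\<^sup>2)
      \<le> C\<^sup>2 * (Gamma (\<beta> 1) * Gamma (\<beta> 1 + 2)) * (?\<Psi> (\<beta> 1) * ?\<Psi> (\<beta> 1 + 2))"
    by (intro mult_left_mono) auto
  moreover have "C\<^sup>2 * (Gamma (\<beta> 1) * Gamma (\<beta> 1 + 2)) * (\<beta> 1 / (\<beta> 1 + 1) * (?\<Psi> (\<beta> 1 + 1))\<^sup>2)
      = (C * ?G * ?\<Psi> (\<beta> 1 + 1))\<^sup>2"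
    unfolding power_mult_distrib GG[symmetric] by (simp only: mult_ac)
  moreover have "C\<^sup>2 * (Gamma (\<beta> 1) * Gamma (\<beta> 1 + 2)) * (?\<Psi> (\<beta> 1) * ?\<Psi> (\<beta> 1 + 2))
      = (C * Gamma (\<beta> 1) * ?\<Psi> (\<beta> 1)) * (C * Gamma (\<beta> 1 + 2) * ?\<Psi> (\<beta> 1 + 2))"
    by (simp only: power2_eq_square mult_ac)
  ultimately show ?thesis
    using H[OF b] H[of "\<beta> 1 + 1", OF add_pos_pos[OF b]] H[of "\<beta> 1 + 2", OF add_pos_pos[OF b]]
    by (simp only: fun_upd_triv zero_less_one zero_less_numeral)
qed

theorem theorem2:
  fixes p q :: nat and \<alpha> \<beta> :: "nat \<Rightarrow> real"
  assumes "q \<ge> 1"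
    and "\<And>l. l \<in> {1..p} \<Longrightarrow> \<alpha> l > 0"
    and "\<And>l. l \<in> {1..q} \<Longrightarrow> \<beta> l > 0"
  shows "(\<forall>A B :: nat \<Rightarrow> real.
            (\<forall>l\<in>{1..p}. A l \<ge> 0) \<longrightarrow> (\<forall>l\<in>{1..q}. B l \<ge> 0) \<longrightarrow>
            1 + (\<Sum>l=1..q. B l) - (\<Sum>l=1..p. A l) > 0 \<longrightarrow>
            (let \<Psi> = (\<lambda>b z. fox_wright p \<alpha> A q (\<beta>(1 := b)) B z)
             in \<forall>z>0. \<Psi> (\<beta> 1) z * \<Psi> (\<beta> 1 + 2) z
                       - \<beta> 1 / (\<beta> 1 + 1) * (\<Psi> (\<beta> 1 + 1) z)\<^sup>2 \<ge> 0))
       \<and> (p \<le> q \<longrightarrow>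
            (\<forall>z>0. hypergeometric p \<alpha> q \<beta> z * hypergeometric p \<alpha> q (\<beta>(1 := \<beta> 1 + 2)) z
                     - (hypergeometric p \<alpha> q (\<beta>(1 := \<beta> 1 + 1)) z)\<^sup>2 \<ge> 0))"

proof (intro conjI allI impI)
  fix A B :: "nat \<Rightarrow> real"
  assume "\<forall>l\<in>{1..p}. A l \<ge> 0" "\<forall>l\<in>{1..q}. B l \<ge> 0"
    and "1 + (\<Sum>l=1..q. B l) - (\<Sum>l=1..p. A l) > 0"
  then show "let \<Psi> = (\<lambda>b z. fox_wright p \<alpha> A q (\<beta>(1 := b)) B z)
      in \<forall>z>0. \<Psi> (\<beta> 1) z * \<Psi> (\<beta> 1 + 2) z - \<beta> 1 / (\<beta> 1 + 1) * (\<Psi> (\<beta> 1 + 1) z)\<^sup>2 \<ge> 0"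
    using fox_wright_Turan_inequality[of q p \<alpha> \<beta> A B] assms
    by (simp only: Let_def fun_upd_triv diff_ge_0_iff_ge) blast
next
  fix z :: real
  assume "p \<le> q" "z > 0"
  then show "hypergeometric p \<alpha> q \<beta> z * hypergeometric p \<alpha> q (\<beta>(1 := \<beta> 1 + 2)) z
      - (hypergeometric p \<alpha> q (\<beta>(1 := \<beta> 1 + 1)) z)\<^sup>2 \<ge> 0"
    using hypergeometric_Turan_inequality[of q p \<alpha> \<beta> z] assms
    by (simp only: diff_ge_0_iff_ge)
qed

end
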